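(* Let $p\in[1,\infty)$. Let $k(x,y,u)$ be a measurable function on $X\times X\times G$ which vanishes whenever $u$ does not belong to a fixed compact set $B\subset G$. Assume that there is a constant $\mathcal C$, independent of $x\in X$ and of $h\in L^p(G)$, such that for all $s>0$, all $x\in X$ and all $h\in L^p(G)$, $$\mu\Big\{v\in G:\Big|\int_Gk_x(v,u)\,h(u^{-1}v)\,d\mu(u)\Big|>s\Big\}\le\frac{\mathcal C^p}{s^p}\|h\|_{L^p(G)}^p,$$ where $k_x(v,u):=k(\mathcal R_vx,\mathcal R_{u^{-1}v}x,u)$. Then the operator $$(Tf)(x)=\int_Gk(x,\mathcal R_{u^{-1}}x,u)\,f(\mathcal R_{u^{-1}}x)\,d\mu(u)$$ is of weak type $(p,p)$; more precisely, $$\mathfrak m\{x\in X:|(Tf)(x)|>s\}\le\frac{\mathcal C^p}{s^p}\|f\|_{L^p(X)}^p$$ for all $s>0$ and all $f\in L^p(X)$.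
   Context: $G$ is a locally compact group with left Haar measure $\mu$ having the following property: given a compact subset $B\subset G$ and $\epsilon>0$, there is an open neighborhood $V$ of the identity of finite measure with $\mu(B^{-1}V)/\mu(V)\le1+\epsilon$. $(X,\mathfrak m)$ is a ($\sigma$-finite) measure space. $\mathcal R=\{\mathcal R_u:u\in G\}$ is a representation of $G$ by measure-preserving transformations of $X$: $\mathcal R_{uv}=\mathcal R_u\mathcal R_v$, $\mathcal R_e=\mathrm{id}$, and $\int_X|f(\mathcal R_ux)|^pd\mathfrak m(x)=\int_X|f(x)|^pd\mathfrak m(x)$ for all $u\in G$; the map $(u,x)\mapsto\mathcal R_ux$ is measurable. It is implicit that the integrals defining $Tf$ and appearing in the hypothesis are well defined (almost everywhere). *)

theory Defs
  imports "HOL-Analysis.Analysis"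
begin

text \<open>
  Groups are written additively, as in the library class \<open>topological_group_add\<close>, which does
  not assume commutativity: \<open>u + v\<close>, \<open>0\<close>, \<open>- u\<close> and \<open>- u + v\<close> stand for \<open>u v\<close>, \<open>e\<close>, the
  inverse of \<open>u\<close>, and the inverse of \<open>u\<close> times \<open>v\<close>.
\<close>

definition left_haar_measure :: "'g::topological_group_add measure \<Rightarrow> bool" where
  "left_haar_measure \<mu> \<longleftrightarrow>
     sets \<mu> = sets borel \<and>
     emeasure \<mu> UNIV \<noteq> 0 \<and>
     (\<forall>g. \<forall>A\<in>sets borel. emeasure \<mu> ((\<lambda>v. g + v) ` A) = emeasure \<mu> A) \<and>
     (\<forall>K. compact K \<longrightarrow> emeasure \<mu> K < \<infinity>) \<and>
     (\<forall>A\<in>sets borel. emeasure \<mu> A = (INF U\<in>{U. open U \<and> A \<subseteq> U}. emeasure \<mu> U)) \<and>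
     (\<forall>U. open U \<longrightarrow> emeasure \<mu> U = (SUP K\<in>{K. compact K \<and> K \<subseteq> U}. emeasure \<mu> K))"

text \<open>
  The set \<open>{- b + v | b v. b \<in> B \<and> v \<in> V}\<close> is a union of translates of \<open>V\<close>, hence open and
  measurable. The quotient is taken in \<open>ennreal\<close>, so it is infinite if the numerator is.
\<close>

definition almost_invariant_nbhds :: "'g::topological_group_add measure \<Rightarrow> bool" where
  "almost_invariant_nbhds \<mu> \<longleftrightarrow>
     (\<forall>B (\<epsilon>::real). compact B \<and> \<epsilon> > 0 \<longrightarrow>
        (\<exists>V. open V \<and> 0 \<in> V \<and> emeasure \<mu> V < \<infinity> \<and>
             emeasure \<mu> {- b + v | b v. b \<in> B \<and> v \<in> V} / emeasure \<mu> V \<le> ennreal (1 + \<epsilon>)))"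

definition measure_preserving_rep ::
    "'x measure \<Rightarrow> ('g::topological_group_add \<Rightarrow> 'x \<Rightarrow> 'x) \<Rightarrow> bool" where
  "measure_preserving_rep M R \<longleftrightarrow>
     (\<lambda>(u, x). R u x) \<in> measurable (borel \<Otimes>\<^sub>M M) M \<and>
     (\<forall>x\<in>space M. R 0 x = x) \<and>
     (\<forall>u v. \<forall>x\<in>space M. R (u + v) x = R u (R v x)) \<and>
     (\<forall>u. distr M M (R u) = M)"

text \<open>
  Preservation of the measure, stated above through the push-forward, amounts to invariance of
  \<open>p\<close>-th power integrals.
\<close>

lemma distr_eq_iff_powr_integral_invariant:
  fixes p :: real
  assumes S: "S \<in> measurable M M" and p: "p > 0"
  shows "distr M M S = M \<longleftrightarrow>
    (\<forall>f\<in>borel_measurable M. (\<integral>\<^sup>+x. ennreal (\<bar>f (S x)\<bar> powr p) \<partial>M) =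
                            (\<integral>\<^sup>+x. ennreal (\<bar>f x :: real\<bar> powr p) \<partial>M))"
proof
  assume d: "distr M M S = M"
  show "\<forall>f\<in>borel_measurable M. (\<integral>\<^sup>+x. ennreal (\<bar>f (S x)\<bar> powr p) \<partial>M) =
          (\<integral>\<^sup>+x. ennreal (\<bar>f x :: real\<bar> powr p) \<partial>M)"
  proof
    fix f :: "'a \<Rightarrow> real" assume f: "f \<in> borel_measurable M"
    have "(\<integral>\<^sup>+x. ennreal (\<bar>f x\<bar> powr p) \<partial>distr M M S) = (\<integral>\<^sup>+x. ennreal (\<bar>f (S x)\<bar> powr p) \<partial>M)"
      using f by (intro nn_integral_distr S) (simp add: d)
    then show "(\<integral>\<^sup>+x. ennreal (\<bar>f (S x)\<bar> powr p) \<partial>M) = (\<integral>\<^sup>+x. ennreal (\<bar>f x\<bar> powr p) \<partial>M)"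
      by (simp add: d)
  qed
next
  assume inv: "\<forall>f\<in>borel_measurable M. (\<integral>\<^sup>+x. ennreal (\<bar>f (S x)\<bar> powr p) \<partial>M) =
                 (\<integral>\<^sup>+x. ennreal (\<bar>f x :: real\<bar> powr p) \<partial>M)"
  show "distr M M S = M"
  proof (rule measure_eqI)
    fix A assume "A \<in> sets (distr M M S)"
    then have A: "A \<in> sets M" by simp
    have ind: "ennreal (\<bar>indicator A y :: real\<bar> powr p) = indicator A y" for y
      using p by (cases "y \<in> A") auto
    have "indicator A \<in> borel_measurable M"
      using A by simp
    from inv[rule_format, OF this]
    have eq: "(\<integral>\<^sup>+x. indicator A (S x) \<partial>M) = (\<integral>\<^sup>+x. indicator A x \<partial>M)"
      unfolding ind .
    have "emeasure (distr M M S) A = (\<integral>\<^sup>+x. indicator A x \<partial>distr M M S)"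
      using A by simp
    also have "\<dots> = (\<integral>\<^sup>+x. indicator A (S x) \<partial>M)"
      using S A by (intro nn_integral_distr) auto
    also have "\<dots> = (\<integral>\<^sup>+x. indicator A x \<partial>M)"
      by (rule eq)
    finally show "emeasure (distr M M S) A = emeasure M A"
      using A by simp
  qed simp
qed

text \<open>
  The scalars range over \<open>real_normed_field\<close>, whose complete instances are the real and the
  complex field, so that both the real and the complex spaces are covered.
\<close>

definition Lp_space :: "real \<Rightarrow> 'a measure \<Rightarrow> ('a \<Rightarrow> 'k::real_normed_field) set" where
  "Lp_space p M = {f \<in> borel_measurable M. integrable M (\<lambda>x. norm (f x) powr p)}"

definition Lp_norm :: "real \<Rightarrow> 'a measure \<Rightarrow> ('a \<Rightarrow> 'k::real_normed_field) \<Rightarrow> real" where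
  "Lp_norm p M f = (\<integral>x. norm (f x) powr p \<partial>M) powr (1 / p)"

text \<open>
  Measurability of \<open>S f\<close> is part of the definition because \<open>emeasure\<close> is \<open>0\<close> on sets that are
  not measurable, which would make the inequality void for them.
\<close>

definition weak_type_bound ::
    "real \<Rightarrow> real \<Rightarrow> 'a measure \<Rightarrow> (('a \<Rightarrow> 'k::real_normed_field) \<Rightarrow> 'a \<Rightarrow> 'k) \<Rightarrow> bool" where
  "weak_type_bound p C M S \<longleftrightarrow>
     (\<forall>f\<in>Lp_space p M.
        S f \<in> borel_measurable M \<and>
        (\<forall>s>0. emeasure M {x \<in> space M. norm (S f x) > s}
                 \<le> ennreal (C powr p / s powr p * Lp_norm p M f powr p)))"

definition kernel_along_orbit ::
    "('g::topological_group_add \<Rightarrow> 'x \<Rightarrow> 'x) \<Rightarrow> ('x \<Rightarrow> 'x \<Rightarrow> 'g \<Rightarrow> 'k) \<Rightarrow> 'x \<Rightarrow> 'g \<Rightarrow> 'g \<Rightarrow> 'k" where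
  "kernel_along_orbit R k x v u = k (R v x) (R (- u + v) x) u"

text \<open>
  In the next two definitions the Bochner integral takes the value \<open>0\<close> where the integrand is not
  integrable; statements about these operators assume integrability almost everywhere.
\<close>

definition group_op ::
    "'g::topological_group_add measure \<Rightarrow> ('g \<Rightarrow> 'g \<Rightarrow> 'k) \<Rightarrow> ('g \<Rightarrow> 'k) \<Rightarrow> 'g \<Rightarrow>
     'k::{real_normed_field, banach, second_countable_topology}" where
  "group_op \<mu> K h v = (\<integral>u. K v u * h (- u + v) \<partial>\<mu>)"

definition transferred_op ::
    "'g::topological_group_add measure \<Rightarrow> ('g \<Rightarrow> 'x \<Rightarrow> 'x) \<Rightarrow> ('x \<Rightarrow> 'x \<Rightarrow> 'g \<Rightarrow> 'k) \<Rightarrow>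
     ('x \<Rightarrow> 'k) \<Rightarrow> 'x \<Rightarrow> 'k::{real_normed_field, banach, second_countable_topology}" where
  "transferred_op \<mu> R k f x = (\<integral>u. k x (R (- u) x) u * f (R (- u) x) \<partial>\<mu>)"

end

theory Submission
  imports Defs
begin

text \<open>
  This is the transference method of Coifman and Weiss. Fix an open set \<open>V\<close> of finite positive
  measure and put \<open>W = {- b + v | b \<in> B, v \<in> V}\<close>. For a point \<open>x\<close> the function
  \<open>h v = f (R v x)\<close> on \<open>W\<close>, extended by zero, carries enough of the orbit of \<open>x\<close> to compute
  \<open>T f\<close> along \<open>V\<close>: if \<open>v \<in> V\<close> and \<open>u \<in> B\<close>, then \<open>- u + v \<in> W\<close>, and \<open>R (- u + v) x\<close> is
  \<open>R (- u)\<close> applied to \<open>R v x\<close>, so the group operator with kernel \<open>kernel_along_orbit R k x\<close>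
  sends \<open>h\<close> to a function that agrees on \<open>V\<close> with \<open>v \<mapsto> T f (R v x)\<close>
  (\<open>group_op_truncated_orbit\<close>). The hypothesis therefore bounds the measure of
  \<open>{v \<in> V. norm (T f (R v x)) > s}\<close> by \<open>(C / s) powr p\<close> times the integral of
  \<open>norm (f (R v x)) powr p\<close> over \<open>v \<in> W\<close>.

  Now integrate over \<open>x\<close>. Since every \<open>R v\<close> preserves the measure \<open>M\<close>, Tonelli's theorem
  (\<open>nn_integral_orbit_average\<close>) turns the left-hand side into \<open>\<mu> V\<close> times the measure of
  \<open>{norm (T f) > s}\<close>, and the right-hand side into \<open>(C / s) powr p\<close> times \<open>\<mu> W\<close> times the
  \<open>p\<close>-th power of the norm of \<open>f\<close> (\<open>transference_with_loss\<close>). The desired inequality holds up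
  to the factor \<open>\<mu> W / \<mu> V\<close>. By \<open>almost_invariant_nbhds\<close> the set \<open>V\<close> can be chosen so that this
  factor is at most \<open>1 + \<epsilon>\<close>, and \<open>\<epsilon>\<close> tends to \<open>0\<close>.

  The Haar measure need not be \<open>\<sigma>\<close>-finite, and the group operation need not be measurable for the
  product of the Borel \<open>\<sigma>\<close>-algebras, so no double integral over the group is ever formed.
  Tonelli's theorem is applied to functions \<open>g (R v x)\<close> of a group element and a point only, with
  \<open>v\<close> confined to one of the sets \<open>V\<close>, \<open>W\<close> of finite measure.
\<close>

lemma measure_preserving_repD:
  assumes "measure_preserving_rep M R"
  shows measure_preserving_rep_joint: "(\<lambda>(u, x). R u x) \<in> measurable (borel \<Otimes>\<^sub>M M) M"
    and measure_preserving_rep_add: "x \<in> space M \<Longrightarrow> R (u + v) x = R u (R v x)"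
    and measure_preserving_rep_distr: "distr M M (R u) = M"
    and measure_preserving_rep_measurable: "R u \<in> measurable M M"
    and measure_preserving_rep_orbit: "x \<in> space M \<Longrightarrow> (\<lambda>v. R v x) \<in> measurable borel M"
    and measure_preserving_rep_space: "x \<in> space M \<Longrightarrow> R u x \<in> space M"
proof -
  show J: "(\<lambda>(u, x). R u x) \<in> measurable (borel \<Otimes>\<^sub>M M) M"
    and "x \<in> space M \<Longrightarrow> R (u + v) x = R u (R v x)" and "distr M M (R u) = M"
    using assms unfolding measure_preserving_rep_def by auto
  show S: "R u \<in> measurable M M"
    using measurable_compose[OF measurable_Pair1'[of u borel M] J] by simp
  show "x \<in> space M \<Longrightarrow> (\<lambda>v. R v x) \<in> measurable borel M"
    using measurable_compose[OF measurable_Pair2'[of x M borel] J] by simp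
  show "x \<in> space M \<Longrightarrow> R u x \<in> space M"
    using S by (rule measurable_space)
qed

lemma left_haar_measureD:
  fixes \<mu> :: "'g::topological_group_add measure"
  assumes "left_haar_measure \<mu>"
  shows left_haar_sets: "sets \<mu> = sets borel"
    and left_haar_space: "space \<mu> = UNIV"
    and left_haar_compact: "compact K \<Longrightarrow> emeasure \<mu> K < \<infinity>"
proof -
  show S: "sets \<mu> = sets borel" and "compact K \<Longrightarrow> emeasure \<mu> K < \<infinity>"
    using assms unfolding left_haar_measure_def by auto
  show "space \<mu> = UNIV"
    using sets_eq_imp_space_eq[OF S] by simp
qed

text \<open>
  Finitely many translates of \<open>V\<close> cover a given compact set. If \<open>V\<close> were a null set, then all
  compact sets would be, and so would the whole group by inner regularity. Positivity
  matters because the bound on the quotient in \<open>almost_invariant_nbhds\<close> is void when the numerator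
  and the denominator are both \<open>0\<close>.
\<close>

lemma left_haar_open_pos:
  fixes \<mu> :: "'g::topological_group_add measure"
  assumes H: "left_haar_measure \<mu>" and V: "open V" "V \<noteq> {}"
  shows "emeasure \<mu> V > 0"
proof (rule ccontr)
  assume "\<not> emeasure \<mu> V > 0"
  then have V0: "emeasure \<mu> V = 0" by simp
  obtain a where a: "a \<in> V" using V by auto
  have sets: "sets \<mu> = sets borel" by (rule left_haar_sets[OF H])
  define T where "T g = (\<lambda>v. - g + v) -` V" for g
  have openT: "open (T g)" for g
    unfolding T_def by (intro open_vimage V continuous_intros)
  have T_img: "T g = (\<lambda>v. g + v) ` V" for g
  proof -
    have "x \<in> (\<lambda>v. g + v) ` V" if "- g + x \<in> V" for x
      using that by (intro image_eqI[of _ _ "- g + x"]) (auto simp: add.assoc[symmetric])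
    then show ?thesis
      by (auto simp: T_def add.assoc[symmetric])
  qed
  have T0: "T g \<in> null_sets \<mu>" for g
  proof -
    have "emeasure \<mu> (T g) = emeasure \<mu> V"
      using H V unfolding T_img left_haar_measure_def by auto
    then show ?thesis using V0 openT[of g] sets by auto
  qed
  have "emeasure \<mu> K = 0" if K: "compact K" for K
  proof -
    \<comment> \<open>The translate by \<open>x - a\<close> moves \<open>a\<close> to \<open>x\<close>.\<close>
    have "K \<subseteq> (\<Union>x\<in>K. T (x - a))"
      using a by (force simp: T_def)
    then obtain F where F: "F \<subseteq> K" "finite F" "K \<subseteq> (\<Union>x\<in>F. T (x - a))"
      using compactE_image[OF K, of K "\<lambda>x. T (x - a)"] openT by blast
    have "(\<Union>x\<in>F. T (x - a)) \<in> null_sets \<mu>"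
      using F T0 by (intro null_sets.finite_UN) auto
    then have "emeasure \<mu> (\<Union>x\<in>F. T (x - a)) = 0" by auto
    moreover have "emeasure \<mu> K \<le> emeasure \<mu> (\<Union>x\<in>F. T (x - a))"
      using F openT sets by (intro emeasure_mono) auto
    ultimately show ?thesis by simp
  qed
  moreover have "emeasure \<mu> UNIV = (SUP K\<in>{K. compact K \<and> K \<subseteq> UNIV}. emeasure \<mu> K)"
    using H open_UNIV unfolding left_haar_measure_def by blast
  ultimately have "emeasure \<mu> UNIV = 0"
    by (auto intro!: antisym SUP_least)
  then show False
    using H by (simp add: left_haar_measure_def)
qed

lemma open_neg_sum_set:
  fixes V :: "'g::topological_group_add set"
  assumes "open V"
  shows "open {- b + v | b v. b \<in> B \<and> v \<in> V}"
proof -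
  have "{- b + v | b v. b \<in> B \<and> v \<in> V} = (\<Union>b\<in>B. (\<lambda>w. b + w) -` V)"
  proof (intro set_eqI iffI)
    fix w assume "w \<in> (\<Union>b\<in>B. (\<lambda>w. b + w) -` V)"
    then obtain b where "b \<in> B" "b + w \<in> V" by auto
    moreover have "w = - b + (b + w)" by (simp add: add.assoc[symmetric])
    ultimately show "w \<in> {- b + v | b v. b \<in> B \<and> v \<in> V}" by blast
  next
    fix w assume "w \<in> {- b + v | b v. b \<in> B \<and> v \<in> V}"
    then obtain b v where b: "b \<in> B" "v \<in> V" "w = - b + v" by auto
    then have "b + w = v" by (simp add: add.assoc[symmetric])
    then show "w \<in> (\<Union>b\<in>B. (\<lambda>w. b + w) -` V)" using b(1,2) by auto
  qed
  moreover have "open ((\<lambda>w. b + w) -` V)" for b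
    by (intro open_vimage assms continuous_intros)
  ultimately show ?thesis by auto
qed

text \<open>
  By Tonelli the average of \<open>g\<close> over the pieces \<open>{R v x | v \<in> A}\<close> of orbits can be computed by
  integrating first over \<open>x\<close>, where each \<open>R v\<close> drops out.
\<close>

lemma nn_integral_orbit_average:
  fixes \<mu> :: "'g::topological_group_add measure" and g :: "'x \<Rightarrow> ennreal"
  assumes sets: "sets \<mu> = sets borel" and M: "sigma_finite_measure M"
    and R: "measure_preserving_rep M R"
    and A: "A \<in> sets \<mu>" "emeasure \<mu> A < \<infinity>" and g: "g \<in> borel_measurable M"
  shows "(\<integral>\<^sup>+x. (\<integral>\<^sup>+v. indicator A v * g (R v x) \<partial>\<mu>) \<partial>M) = emeasure \<mu> A * (\<integral>\<^sup>+x. g x \<partial>M)"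
    and "(\<lambda>x. \<integral>\<^sup>+v. indicator A v * g (R v x) \<partial>\<mu>) \<in> borel_measurable M"
proof -
  \<comment> \<open>Cutting \<open>\<mu>\<close> down to \<open>A\<close> makes it finite, as Tonelli's theorem requires.\<close>
  define \<nu> where "\<nu> = density \<mu> (indicator A)"
  interpret M: sigma_finite_measure M by (rule M)
  interpret \<nu>: finite_measure \<nu>
    using A by (intro finite_measureI) (simp add: \<nu>_def emeasure_density)
  interpret P: pair_sigma_finite \<nu> M ..
  have sets\<nu>: "sets \<nu> = sets borel"
    using sets by (simp add: \<nu>_def)
  have "measurable (\<nu> \<Otimes>\<^sub>M M) M = measurable (borel \<Otimes>\<^sub>M M) M"
    by (intro measurable_cong_sets sets_pair_measure_cong sets\<nu> refl)
  then have J: "(\<lambda>(v, x). R v x) \<in> measurable (\<nu> \<Otimes>\<^sub>M M) M"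
    using measure_preserving_rep_joint[OF R] by simp
  have G: "(\<lambda>(v, x). g (R v x)) \<in> borel_measurable (\<nu> \<Otimes>\<^sub>M M)"
    using measurable_compose[OF J g] by (simp add: case_prod_beta')
  have inner: "(\<integral>\<^sup>+v. indicator A v * g (R v x) \<partial>\<mu>) = (\<integral>\<^sup>+v. g (R v x) \<partial>\<nu>)"
    if "x \<in> space M" for x
  proof -
    have "(\<lambda>v. R v x) \<in> measurable \<mu> M"
      using measure_preserving_rep_orbit[OF R that] measurable_cong_sets[OF sets refl] by blast
    then have "(\<lambda>v. g (R v x)) \<in> borel_measurable \<mu>"
      using g by (rule measurable_compose)
    then show ?thesis
      using A unfolding \<nu>_def by (subst nn_integral_density) auto
  qed
  have "(\<integral>\<^sup>+x. (\<integral>\<^sup>+v. indicator A v * g (R v x) \<partial>\<mu>) \<partial>M) = (\<integral>\<^sup>+x. (\<integral>\<^sup>+v. g (R v x) \<partial>\<nu>) \<partial>M)"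
    by (intro nn_integral_cong inner)
  also have "\<dots> = (\<integral>\<^sup>+v. (\<integral>\<^sup>+x. g (R v x) \<partial>M) \<partial>\<nu>)"
    using P.Fubini[OF G] by simp
  also have "\<dots> = (\<integral>\<^sup>+v. (\<integral>\<^sup>+x. g x \<partial>M) \<partial>\<nu>)"
  proof (rule nn_integral_cong)
    fix v
    have "(\<integral>\<^sup>+x. g (R v x) \<partial>M) = (\<integral>\<^sup>+x. g x \<partial>distr M M (R v))"
      using g by (intro nn_integral_distr[symmetric] measure_preserving_rep_measurable[OF R]) simp
    then show "(\<integral>\<^sup>+x. g (R v x) \<partial>M) = (\<integral>\<^sup>+x. g x \<partial>M)"
      by (simp add: measure_preserving_rep_distr[OF R])
  qed
  also have "\<dots> = emeasure \<mu> A * (\<integral>\<^sup>+x. g x \<partial>M)"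
  proof -
    have "A \<inter> space \<mu> = A" using A sets.sets_into_space by auto
    then have "emeasure \<nu> (space \<nu>) = emeasure \<mu> A"
      using A by (simp add: \<nu>_def emeasure_density)
    then show ?thesis by (simp add: mult.commute)
  qed
  finally show "(\<integral>\<^sup>+x. (\<integral>\<^sup>+v. indicator A v * g (R v x) \<partial>\<mu>) \<partial>M) = emeasure \<mu> A * (\<integral>\<^sup>+x. g x \<partial>M)" .
  have "(\<lambda>x. \<integral>\<^sup>+v. g (R v x) \<partial>\<nu>) \<in> borel_measurable M"
    using \<nu>.borel_measurable_nn_integral[of "\<lambda>x v. g (R v x)" M] measurable_pair_swap[OF G]
    by (simp add: case_prod_beta')
  then show "(\<lambda>x. \<integral>\<^sup>+v. indicator A v * g (R v x) \<partial>\<mu>) \<in> borel_measurable M"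
    using inner by (simp cong: measurable_cong)
qed

text \<open>
  The integrand is jointly measurable in \<open>x\<close> and \<open>u\<close> because inversion is continuous. Since it
  vanishes off \<open>B\<close>, it may be integrated against the restriction of \<open>\<mu>\<close> to \<open>B\<close>, which is finite.
\<close>

lemma transferred_op_measurable:
  fixes \<mu> :: "'g::topological_group_add measure"
    and k :: "'x \<Rightarrow> 'x \<Rightarrow> 'g \<Rightarrow> 'k::{real_normed_field, banach, second_countable_topology}"
  assumes sets: "sets \<mu> = sets borel" and R: "measure_preserving_rep M R"
    and k: "(\<lambda>(x, y, u). k x y u) \<in> borel_measurable (M \<Otimes>\<^sub>M (M \<Otimes>\<^sub>M borel))"
    and B: "B \<in> sets \<mu>" "emeasure \<mu> B < \<infinity>"
    and van: "\<And>x y u. x \<in> space M \<Longrightarrow> y \<in> space M \<Longrightarrow> u \<notin> B \<Longrightarrow> k x y u = 0"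
    and f: "f \<in> borel_measurable M"
  shows "transferred_op \<mu> R k f \<in> borel_measurable M"
proof -
  define \<nu> where "\<nu> = density \<mu> (indicator B)"
  interpret \<nu>: finite_measure \<nu>
    using B by (intro finite_measureI) (simp add: \<nu>_def emeasure_density)
  have sets\<nu>: "sets \<nu> = sets borel"
    using sets by (simp add: \<nu>_def)
  define \<Phi> where "\<Phi> x u = k x (R (- u) x) u * f (R (- u) x)" for x u
  have neg: "(\<lambda>u::'g. - u) \<in> borel_measurable borel"
    by (intro borel_measurable_continuous_onI continuous_intros)
  have "(\<lambda>q. - snd q) \<in> borel_measurable (M \<Otimes>\<^sub>M (borel :: 'g measure))"
    using measurable_snd neg by (rule measurable_compose)
  then have "(\<lambda>q. (- snd q, fst q)) \<in> measurable (M \<Otimes>\<^sub>M (borel :: 'g measure)) (borel \<Otimes>\<^sub>M M)"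
    by (intro measurable_Pair measurable_fst)
  from measurable_compose[OF this measure_preserving_rep_joint[OF R]]
  have J[measurable]: "(\<lambda>q. R (- snd q) (fst q)) \<in> measurable (M \<Otimes>\<^sub>M borel) M" by simp
  have "(\<lambda>q. (fst q, R (- snd q) (fst q), snd q)) \<in> measurable (M \<Otimes>\<^sub>M borel) (M \<Otimes>\<^sub>M (M \<Otimes>\<^sub>M borel))"
    by measurable
  from measurable_compose[OF this k] measurable_compose[OF J f]
  have "(\<lambda>q. \<Phi> (fst q) (snd q)) \<in> borel_measurable (M \<Otimes>\<^sub>M borel)"
    unfolding \<Phi>_def by (intro borel_measurable_times) auto
  moreover have "borel_measurable (M \<Otimes>\<^sub>M \<nu>) = (borel_measurable (M \<Otimes>\<^sub>M borel) :: ('x \<times> 'g \<Rightarrow> 'k) set)"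
    by (intro measurable_cong_sets sets_pair_measure_cong sets\<nu> refl)
  ultimately have \<Phi>: "(\<lambda>(x, u). \<Phi> x u) \<in> borel_measurable (M \<Otimes>\<^sub>M \<nu>)"
    by (simp add: case_prod_beta')
  have "transferred_op \<mu> R k f x = (\<integral>u. \<Phi> x u \<partial>\<nu>)" if x: "x \<in> space M" for x
  proof -
    have "(\<lambda>u. \<Phi> x u) \<in> borel_measurable \<nu>"
      using measurable_compose[OF measurable_Pair1'[OF x] \<Phi>] by simp
    then have m: "(\<lambda>u. \<Phi> x u) \<in> borel_measurable \<mu>" by (simp add: \<nu>_def)
    have "(\<integral>u. \<Phi> x u \<partial>\<nu>) = (\<integral>u. indicator B u *\<^sub>R \<Phi> x u \<partial>\<mu>)"
    proof -
      have "\<nu> = density \<mu> (\<lambda>u. ennreal (indicator B u))"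
        by (simp add: \<nu>_def ennreal_indicator)
      then show ?thesis
        using m B by (simp add: integral_density)
    qed
    also have "\<dots> = (\<integral>u. \<Phi> x u \<partial>\<mu>)"
      using van[OF x measure_preserving_rep_space[OF R x]]
      by (intro Bochner_Integration.integral_cong) (auto simp: \<Phi>_def indicator_def)
    finally show ?thesis by (simp add: transferred_op_def \<Phi>_def)
  qed
  moreover have "(\<lambda>x. \<integral>u. \<Phi> x u \<partial>\<nu>) \<in> borel_measurable M"
    by (rule \<nu>.borel_measurable_lebesgue_integral[OF \<Phi>])
  ultimately show ?thesis
    by (simp cong: measurable_cong)
qed

text \<open>
  The truncation to \<open>W\<close> is invisible at \<open>v \<in> V\<close>: it could only change the integrand at points \<open>u\<close>
  with \<open>- u + v \<notin> W\<close>, and such \<open>u\<close> lie outside \<open>B\<close>, where the kernel vanishes. The two integrands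
  agree pointwise.
\<close>

lemma group_op_truncated_orbit:
  assumes R: "measure_preserving_rep M R"
    and van: "\<And>x y u. x \<in> space M \<Longrightarrow> y \<in> space M \<Longrightarrow> u \<notin> B \<Longrightarrow> k x y u = 0"
    and x: "x \<in> space M" and v: "v \<in> V"
    and W: "W = {- b + v | b v. b \<in> B \<and> v \<in> V}"
  shows "group_op \<mu> (kernel_along_orbit R k x) (\<lambda>w. indicator W w *\<^sub>R f (R w x)) v
    = transferred_op \<mu> R k f (R v x)"
proof -
  have "k (R v x) (R (- u + v) x) u * (indicator W (- u + v) *\<^sub>R f (R (- u + v) x))
      = k (R v x) (R (- u) (R v x)) u * f (R (- u) (R v x))" for u
  proof (cases "u \<in> B")
    case True
    then have "- u + v \<in> W" using W v by blast
    then show ?thesis by (simp add: measure_preserving_rep_add[OF R x])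
  next
    case False
    then show ?thesis
      using van[OF measure_preserving_rep_space[OF R x] measure_preserving_rep_space[OF R x]]
        van[OF measure_preserving_rep_space[OF R x]
          measure_preserving_rep_space[OF R measure_preserving_rep_space[OF R x]]]
      by simp
  qed
  then show ?thesis
    by (simp add: group_op_def transferred_op_def kernel_along_orbit_def)
qed

lemma Lp_norm_powr_eq_nn_integral:
  assumes "f \<in> Lp_space p M" "p > 0"
  shows "ennreal (Lp_norm p M f powr p) = (\<integral>\<^sup>+x. ennreal (norm (f x) powr p) \<partial>M)"
proof -
  have "0 \<le> (\<integral>x. norm (f x) powr p \<partial>M)"
    by (intro integral_nonneg_AE) auto
  then have "Lp_norm p M f powr p = (\<integral>x. norm (f x) powr p \<partial>M)"
    using assms by (simp add: Lp_norm_def powr_powr)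
  then show ?thesis
    using assms by (simp add: Lp_space_def nn_integral_eq_integral)
qed

text \<open>
  The truncated orbit function may fail to lie in \<open>L\<^sup>p\<close> of the group on a null set of points
  \<open>x\<close>, but not on a larger one, since its \<open>p\<close>-th power integral has finite integral over \<open>x\<close>.
  This suffices, because the estimate on the group is itself integrated over \<open>x\<close>.
\<close>

lemma transference_with_loss:
  fixes \<mu> :: "'g::topological_group_add measure"
    and k :: "'x \<Rightarrow> 'x \<Rightarrow> 'g \<Rightarrow> 'k::{real_normed_field, banach, second_countable_topology}"
  assumes sets: "sets \<mu> = sets borel" and M: "sigma_finite_measure M"
    and R: "measure_preserving_rep M R" and p: "p > 0"
    and van: "\<And>x y u. x \<in> space M \<Longrightarrow> y \<in> space M \<Longrightarrow> u \<notin> B \<Longrightarrow> k x y u = 0"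
    and bound: "\<And>x. x \<in> space M \<Longrightarrow> weak_type_bound p C \<mu> (group_op \<mu> (kernel_along_orbit R k x))"
    and Tf: "transferred_op \<mu> R k f \<in> borel_measurable M"
    and f: "f \<in> Lp_space p M" and s: "s > 0"
    and W: "W = {- b + v | b v. b \<in> B \<and> v \<in> V}"
    and V: "V \<in> sets \<mu>" "emeasure \<mu> V < \<infinity>" and W_fin: "W \<in> sets \<mu>" "emeasure \<mu> W < \<infinity>"
  shows "emeasure \<mu> V * emeasure M {x \<in> space M. norm (transferred_op \<mu> R k f x) > s}
    \<le> emeasure \<mu> W * ennreal (C powr p / s powr p * Lp_norm p M f powr p)"
proof -
  define E where "E = {x \<in> space M. norm (transferred_op \<mu> R k f x) > s}"
  define c where "c = C powr p / s powr p"
  define g where "g x = ennreal (norm (f x) powr p)" for x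
  define I where "I x = (\<integral>\<^sup>+v. indicator W v * g (R v x) \<partial>\<mu>)" for x
  have c0: "c \<ge> 0" by (simp add: c_def)
  have space: "space \<mu> = UNIV"
    using sets_eq_imp_space_eq[OF sets] by simp
  have fm: "f \<in> borel_measurable M"
    using f by (simp add: Lp_space_def)
  have E: "E \<in> sets M"
    unfolding E_def using Tf by measurable
  have g: "g \<in> borel_measurable M"
    unfolding g_def using fm by measurable
  have nn_g: "(\<integral>\<^sup>+x. g x \<partial>M) = ennreal (Lp_norm p M f powr p)"
    unfolding g_def by (rule Lp_norm_powr_eq_nn_integral[OF f p, symmetric])
  have I: "(\<integral>\<^sup>+x. I x \<partial>M) = emeasure \<mu> W * ennreal (Lp_norm p M f powr p)"
    using nn_integral_orbit_average(1)[OF sets M R W_fin g] by (simp add: I_def nn_g)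
  have I_meas: "I \<in> borel_measurable M"
    using nn_integral_orbit_average(2)[OF sets M R W_fin g] by (simp add: I_def[abs_def])
  have "(\<integral>\<^sup>+x. I x \<partial>M) \<noteq> \<infinity>"
    unfolding I using W_fin by (simp add: ennreal_mult_eq_top_iff)
  then have I_fin: "AE x in M. I x \<noteq> \<infinity>"
    using I_meas by (intro nn_integral_PInf_AE) auto
  have pointwise: "(\<integral>\<^sup>+v. indicator V v * indicator E (R v x) \<partial>\<mu>) \<le> ennreal c * I x"
    if x: "x \<in> space M" and fin: "I x \<noteq> \<infinity>" for x
  proof -
    define h where "h w = indicator W w *\<^sub>R f (R w x)" for w
    have orbit: "(\<lambda>v. R v x) \<in> measurable \<mu> M"
      using measure_preserving_rep_orbit[OF R x] measurable_cong_sets[OF sets refl] by blast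
    have hm: "h \<in> borel_measurable \<mu>"
      unfolding h_def using measurable_compose[OF orbit fm] W_fin by measurable
    have h_g: "ennreal (norm (h w) powr p) = indicator W w * g (R w x)" for w
      using p by (simp add: h_def g_def indicator_def)
    then have nn_h: "(\<integral>\<^sup>+w. ennreal (norm (h w) powr p) \<partial>\<mu>) = I x"
      by (simp add: I_def)
    have h: "h \<in> Lp_space p \<mu>"
    proof -
      have "integrable \<mu> (\<lambda>w. norm (h w) powr p)"
        using hm fin nn_h by (intro integrableI_nonneg) (auto simp: less_top)
      then show ?thesis using hm by (simp add: Lp_space_def)
    qed
    let ?S = "group_op \<mu> (kernel_along_orbit R k x) h"
    have Sm: "?S \<in> borel_measurable \<mu>"
      and Sb: "emeasure \<mu> {v \<in> space \<mu>. norm (?S v) > s} \<le> ennreal (c * Lp_norm p \<mu> h powr p)"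
      using bound[OF x] h s unfolding weak_type_bound_def c_def by auto
    have "(\<integral>\<^sup>+v. indicator V v * indicator E (R v x) \<partial>\<mu>)
        \<le> (\<integral>\<^sup>+v. indicator {v \<in> space \<mu>. norm (?S v) > s} v \<partial>\<mu>)"
    proof (intro nn_integral_mono)
      fix v
      have "?S v = transferred_op \<mu> R k f (R v x)" if "v \<in> V"
        using group_op_truncated_orbit[OF R van x that W, where \<mu> = \<mu> and f = f] by (simp add: h_def[abs_def])
      then show "indicator V v * indicator E (R v x)
          \<le> (indicator {v \<in> space \<mu>. norm (?S v) > s} v :: ennreal)"
        by (auto simp: indicator_def E_def space)
    qed
    also have "\<dots> = emeasure \<mu> {v \<in> space \<mu>. norm (?S v) > s}"
      using Sm by (intro nn_integral_indicator) measurable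
    also have "\<dots> \<le> ennreal (c * Lp_norm p \<mu> h powr p)" by (rule Sb)
    also have "\<dots> = ennreal c * I x"
      using c0 by (simp add: ennreal_mult Lp_norm_powr_eq_nn_integral[OF h p] nn_h)
    finally show ?thesis .
  qed
  have "emeasure \<mu> V * emeasure M E = emeasure \<mu> V * (\<integral>\<^sup>+x. indicator E x \<partial>M)"
    using E by simp
  also have "\<dots> = (\<integral>\<^sup>+x. (\<integral>\<^sup>+v. indicator V v * indicator E (R v x) \<partial>\<mu>) \<partial>M)"
    using nn_integral_orbit_average(1)[OF sets M R V, of "indicator E"] E by simp
  also have "\<dots> \<le> (\<integral>\<^sup>+x. ennreal c * I x \<partial>M)"
  proof (rule nn_integral_mono_AE)
    show "AE x in M. (\<integral>\<^sup>+v. indicator V v * indicator E (R v x) \<partial>\<mu>) \<le> ennreal c * I x"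
      using AE_space[of M] I_fin by eventually_elim (rule pointwise)
  qed
  also have "\<dots> = ennreal c * (emeasure \<mu> W * ennreal (Lp_norm p M f powr p))"
    using I_meas by (simp add: nn_integral_cmult I)
  also have "\<dots> = emeasure \<mu> W * ennreal (c * Lp_norm p M f powr p)"
    using c0 by (simp add: ennreal_mult mult_ac)
  finally show ?thesis by (simp add: E_def c_def)
qed

theorem theorem4p1:
  fixes \<mu> :: "'g::{topological_group_add, t2_space} measure"
    and M :: "'x measure"
    and R :: "'g \<Rightarrow> 'x \<Rightarrow> 'x"
    and k :: "'x \<Rightarrow> 'x \<Rightarrow> 'g \<Rightarrow> 'k::{real_normed_field, banach, second_countable_topology}"
    and B :: "'g set"
    and p C :: real
  assumes "locally_compact_space (euclidean :: 'g topology)"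
    and "left_haar_measure \<mu>"
    and "almost_invariant_nbhds \<mu>"
    and "sigma_finite_measure M"
    and "measure_preserving_rep M R"
    and "p \<ge> 1"
    and "(\<lambda>(x, y, u). k x y u) \<in> borel_measurable (M \<Otimes>\<^sub>M (M \<Otimes>\<^sub>M borel))"
    and "compact B"
    and "\<And>x y u. x \<in> space M \<Longrightarrow> y \<in> space M \<Longrightarrow> u \<notin> B \<Longrightarrow> k x y u = 0"
    and "\<And>x h. x \<in> space M \<Longrightarrow> h \<in> Lp_space p \<mu> \<Longrightarrow>
           AE v in \<mu>. integrable \<mu> (\<lambda>u. kernel_along_orbit R k x v u * h (- u + v))"
    and "\<And>f. f \<in> Lp_space p M \<Longrightarrow>
           AE x in M. integrable \<mu> (\<lambda>u. k x (R (- u) x) u * f (R (- u) x))"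
    and "C \<ge> 0"
    and "\<And>x. x \<in> space M \<Longrightarrow> weak_type_bound p C \<mu> (group_op \<mu> (kernel_along_orbit R k x))"
  shows "weak_type_bound p C M (transferred_op \<mu> R k)"
  unfolding weak_type_bound_def
proof (intro ballI conjI allI impI)
  note H = assms(2) and R = assms(5) and van = assms(9)
  have sets: "sets \<mu> = sets borel" by (rule left_haar_sets[OF H])
  have p: "p > 0" using assms(6) by simp
  fix f :: "'x \<Rightarrow> 'k" assume f: "f \<in> Lp_space p M"
  have B: "B \<in> sets \<mu>" "emeasure \<mu> B < \<infinity>"
    using assms(8) left_haar_compact[OF H] sets by (auto intro: borel_closed compact_imp_closed)
  show Tf: "transferred_op \<mu> R k f \<in> borel_measurable M"
    using f by (intro transferred_op_measurable[OF sets R assms(7) B van]) (auto simp: Lp_space_def)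
  fix s :: real assume s: "s > 0"
  define E where "E = {x \<in> space M. norm (transferred_op \<mu> R k f x) > s}"
  define D where "D = C powr p / s powr p * Lp_norm p M f powr p"
  have D0: "D \<ge> 0" by (simp add: D_def)
  have bound: "emeasure M E \<le> ennreal ((1 + \<epsilon>) * D)" if \<epsilon>: "\<epsilon> > 0" for \<epsilon>
  proof -
    obtain V where V: "open V" "0 \<in> V" "emeasure \<mu> V < \<infinity>"
      and "emeasure \<mu> {- b + v | b v. b \<in> B \<and> v \<in> V} / emeasure \<mu> V \<le> ennreal (1 + \<epsilon>)"
      using assms(3,8) \<epsilon> unfolding almost_invariant_nbhds_def by blast
    moreover define W where "W = {- b + v | b v. b \<in> B \<and> v \<in> V}"
    ultimately have ratio: "emeasure \<mu> W / emeasure \<mu> V \<le> ennreal (1 + \<epsilon>)" by simp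
    have pos: "emeasure \<mu> V > 0"
      using left_haar_open_pos[OF H, of V] V by auto
    have "emeasure \<mu> W = emeasure \<mu> W / emeasure \<mu> V * emeasure \<mu> V"
      using pos V by (simp add: ennreal_divide_times ennreal_mult_divide_eq)
    also have "\<dots> \<le> ennreal (1 + \<epsilon>) * emeasure \<mu> V"
      by (intro mult_right_mono ratio) simp
    finally have W_le: "emeasure \<mu> W \<le> ennreal (1 + \<epsilon>) * emeasure \<mu> V" .
    have W_fin: "emeasure \<mu> W < \<infinity>"
      using V by (intro le_less_trans[OF W_le]) (simp add: ennreal_mult_less_top)
    have V_sets: "V \<in> sets \<mu>" "W \<in> sets \<mu>"
      using V(1) open_neg_sum_set[OF V(1), of B] by (simp_all add: sets W_def)
    have "emeasure \<mu> V * emeasure M E \<le> emeasure \<mu> W * ennreal D"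
      unfolding E_def D_def
      by (rule transference_with_loss[OF sets assms(4) R p van assms(13) Tf f s W_def
            V_sets(1) V(3) V_sets(2) W_fin])
    also have "\<dots> \<le> ennreal (1 + \<epsilon>) * emeasure \<mu> V * ennreal D"
      by (intro mult_right_mono W_le) simp
    also have "\<dots> = emeasure \<mu> V * ennreal ((1 + \<epsilon>) * D)"
      using D0 \<epsilon> by (simp add: ennreal_mult mult_ac)
    finally show ?thesis
      using pos V by (simp add: ennreal_mult_le_mult_iff)
  qed
  have "((\<lambda>\<epsilon>. ennreal ((1 + \<epsilon>) * D)) \<longlongrightarrow> ennreal ((1 + 0) * D)) (at_right 0)"
    by (intro tendsto_intros)
  then have "emeasure M E \<le> ennreal ((1 + 0) * D)"
    by (rule tendsto_lowerbound)
      (auto intro!: bound simp: eventually_at_right_less eventually_at_topological)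
  then show "emeasure M {x \<in> space M. norm (transferred_op \<mu> R k f x) > s}
      \<le> ennreal (C powr p / s powr p * Lp_norm p M f powr p)"
    by (simp add: E_def D_def)
qed

end
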